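(* Let $v\ge 2$ and $t\ge 1$ be integers, and let $M=M_t(v,t+1)$ be the $t$-inclusion matrix defined in the context, over the reals. There exists a basis of the null space $\{\mathbf T\in\mathbb R^{V^{t+1}}: M\mathbf T=\mathbf 0\}$ consisting only of frequency vectors of $t$-$(v,t+1)$ intercalates.
   Context: Let $V=\{0,1,\ldots,v-1\}$ and $k=t+1$. For a $t$-subset $I=\{i_1<\cdots<i_t\}$ of $\{1,\ldots,k\}$ and $u_1,\ldots,u_t\in V$, say $(u_1,\ldots,u_t)_I\in(x_1,\ldots,x_k)$ iff $u_j=x_{i_j}$ for all $j$. The matrix $M_t(v,k)$ has columns indexed by $V^k$, rows indexed by all $(u_1,\ldots,u_t)_I$ with $I$ ranging over $t$-subsets of $\{1,\ldots,k\}$, and entry $1$ in row $(u_1,\ldots,u_t)_I$, column $\mathbf x$ iff $(u_1,\ldots,u_t)_I\in\mathbf x$, else $0$. A homogeneous polynomial of degree $k$ in non-commuting variables $x_0,\ldots,x_{v-1}$ (so monomials $x_{a_1}x_{a_2}\cdots x_{a_k}$ are ordered words) corresponds to the frequency vector $\mathbf T\in\mathbb R^{V^k}$ whose entry at $(a_1,\ldots,a_k)$ is the coefficient of the monomial $x_{a_1}\cdots x_{a_k}$. A $t$-$(v,t+1)$ intercalate is the polynomial \[ (x_{i_1}-x_{j_1})(x_{i_2}-x_{j_2})\cdots(x_{i_{t+1}}-x_{j_{t+1}}), \] expanded in the non-commutative ring, where $i_l,j_l\in V$ and $i_l\neq j_l$ for each $l$. *)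

theory Defs
  imports Complex_Main "HOL-Library.Function_Algebras" "HOL-Library.Poly_Mapping"
begin

text \<open>
  Words form the free monoid, written additively because the product on
  \<^typ>\<open>'a \<Rightarrow>\<^sub>0 'b\<close> is convolution over an additive monoid of exponents. Hence
  \<^typ>\<open>'a list \<Rightarrow>\<^sub>0 real\<close> is the ring of real polynomials in non-commuting variables indexed by
  \<^typ>\<open>'a\<close>, and \<^const>\<open>Poly_Mapping.lookup\<close> reads off the coefficient of a word.
\<close>

instantiation list :: (type) monoid_add
begin

definition zero_list :: "'a list" where "0 = []"

definition plus_list :: "'a list \<Rightarrow> 'a list \<Rightarrow> 'a list" where "xs + ys = xs @ ys"

instance by standard (simp_all add: zero_list_def plus_list_def)

end

type_synonym nc_poly = "nat list \<Rightarrow>\<^sub>0 real"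

definition nc_var :: "nat \<Rightarrow> nc_poly" where
  "nc_var a = Poly_Mapping.single [a] 1"

instantiation "fun" :: (type, real_vector) real_vector
begin

definition scaleR_fun :: "real \<Rightarrow> ('a \<Rightarrow> 'b) \<Rightarrow> 'a \<Rightarrow> 'b" where
  "c *\<^sub>R f = (\<lambda>x. c *\<^sub>R f x)"

instance
  by standard (auto simp: scaleR_fun_def fun_eq_iff scaleR_add_right scaleR_add_left)

end

text \<open>The set $V^k$, a $k$-tuple over $V = \{0, \ldots, v-1\}$ being a list.\<close>

definition tuples :: "nat \<Rightarrow> nat \<Rightarrow> nat list set" where
  "tuples v k = {x. length x = k \<and> set x \<subseteq> {0..<v}}"

text \<open>
  The positions in \<open>I\<close> are counted from 1 and list entries from 0.
\<close>

definition occurs_in :: "nat set \<times> nat list \<Rightarrow> nat list \<Rightarrow> bool" where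
  "occurs_in r x = (case r of (I, u) \<Rightarrow>
     \<forall>j<card I. u ! j = x ! (sorted_list_of_set I ! j - 1))"

definition incl_rows :: "nat \<Rightarrow> nat \<Rightarrow> nat \<Rightarrow> (nat set \<times> nat list) set" where
  "incl_rows t v k = {I. I \<subseteq> {1..k} \<and> card I = t} \<times> tuples v t"

text \<open>
  The entries of $M_t(v,k)$; its rows are indexed by \<^term>\<open>incl_rows t v k\<close> and its columns by
  \<^term>\<open>tuples v k\<close>, and the formula for an entry does not depend on the parameters.
\<close>

definition incl_entry :: "nat set \<times> nat list \<Rightarrow> nat list \<Rightarrow> real" where
  "incl_entry r x = (if occurs_in r x then 1 else 0)"

text \<open>
  For finite \<open>C\<close>, the space $\mathbb{R}^C$ is represented by the real functions vanishing
  outside \<open>C\<close>.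
\<close>

definition null_space :: "'r set \<Rightarrow> 'c set \<Rightarrow> ('r \<Rightarrow> 'c \<Rightarrow> real) \<Rightarrow> ('c \<Rightarrow> real) set" where
  "null_space R C A =
     {T. (\<forall>x. x \<notin> C \<longrightarrow> T x = 0) \<and> (\<forall>r\<in>R. (\<Sum>x\<in>C. A r x * T x) = 0)}"

definition freq_vec :: "nat \<Rightarrow> nat \<Rightarrow> nc_poly \<Rightarrow> nat list \<Rightarrow> real" where
  "freq_vec v k p = (\<lambda>x. if x \<in> tuples v k then Poly_Mapping.lookup p x else 0)"

definition intercalate :: "nat \<Rightarrow> nat \<Rightarrow> nc_poly \<Rightarrow> bool" where
  "intercalate t v p \<longleftrightarrow>
     (\<exists>i j. (\<forall>l\<in>{1..t+1}. i l < v \<and> j l < v \<and> i l \<noteq> j l) \<and>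
            p = (\<Prod>l\<leftarrow>[1..<t+2]. nc_var (i l) - nc_var (j l)))"

end

theory Submission
  imports Defs
begin

text \<open>
  The null space consists of the functions on $V^{t+1}$ whose sum over every axis-parallel
  line vanishes. Apply the map $e_a \mapsto e_a - e_0$ in every tensor factor to
  $T = \sum_x T(x)\, e_{x_1} \otimes \cdots \otimes e_{x_{t+1}}$. Every term of the expansion
  containing a factor $-e_0$ carries a line sum of $T$ and vanishes, hence
  $T = \sum_x T(x) \prod_l (e_{x_l} - e_0)$, a combination of intercalates. A basis is then
  extracted from this spanning set.
\<close>

section \<open>Coefficients of products of differences of variables\<close>

fun diff_coeff :: "(nat \<times> nat) list \<Rightarrow> nat list \<Rightarrow> real" where
  "diff_coeff [] [] = 1"
| "diff_coeff ((a, b) # ps) (c # cs) = (of_bool (c = a) - of_bool (c = b)) * diff_coeff ps cs"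
| "diff_coeff _ _ = 0"

text \<open>In the free monoid a word splits as \<open>[a] + y\<close> in at most one way, so the
  convolution has at most one nonzero term: left multiplication by a variable only consumes the
  first letter.\<close>

lemma lookup_nc_var_times:
  "Poly_Mapping.lookup (nc_var a * q) x =
    (case x of [] \<Rightarrow> 0 | c # y \<Rightarrow> of_bool (c = a) * Poly_Mapping.lookup q y)"
proof -
  have "Poly_Mapping.lookup (nc_var a * q) x =
      (\<Sum>l. (1 when [a] = l) * (\<Sum>y. Poly_Mapping.lookup q y when x = l + y))"
    by (simp add: lookup_mult nc_var_def lookup_single)
  also have "\<dots> = (\<Sum>l. (\<Sum>y. Poly_Mapping.lookup q y when x = l + y) when [a] = l)"
    by (rule Sum_any.cong) (simp add: when_def)
  also have "\<dots> = (\<Sum>y. Poly_Mapping.lookup q y when x = a # y)"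
    by (simp add: plus_list_def)
  also have "\<dots> = (case x of [] \<Rightarrow> 0 | c # y \<Rightarrow> of_bool (c = a) * Poly_Mapping.lookup q y)"
  proof (cases x)
    case (Cons c y)
    \<comment> \<open>The first-letter test becomes a scalar factor, which leaves a condition on the
      summation variable alone, met only at \<open>y\<close>.\<close>
    have "(\<Sum>y'. Poly_Mapping.lookup q y' when x = a # y') =
        (\<Sum>y'. (of_bool (c = a) * Poly_Mapping.lookup q y') when y' = y)"
      by (rule Sum_any.cong) (auto simp: Cons when_def)
    then show ?thesis
      by (simp add: Cons)
  qed simp
  finally show ?thesis .
qed

text \<open>Each factor consumes one letter of the word. The product is homogeneous of degree
  \<open>length ps\<close>, which is why \<open>diff_coeff\<close> returns 0 when the lengths
  differ.\<close>

lemma lookup_prod_diff: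
  "Poly_Mapping.lookup (\<Prod>(a, b)\<leftarrow>ps. nc_var a - nc_var b) x = diff_coeff ps x"
proof (induction ps arbitrary: x)
  case Nil
  show ?case
    by (cases x) (auto simp: lookup_one zero_list_def when_def)
next
  case (Cons p ps)
  show ?case
    by (cases p; cases x)
      (simp_all add: left_diff_distrib lookup_minus lookup_nc_var_times Cons.IH)
qed

section \<open>Tuples and vanishing line sums\<close>

lemma finite_tuples: "finite (tuples v k)"
  using finite_lists_length_eq[of "{0..<v}" k] by (simp add: tuples_def conj_commute)

lemma tuples_0: "tuples v 0 = {[]}"
  by (auto simp: tuples_def)

lemma tuples_Suc: "tuples v (Suc k) = (\<lambda>(a, x). a # x) ` ({0..<v} \<times> tuples v k)"
  by (auto simp: tuples_def length_Suc_conv image_iff)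

lemma sum_tuples_Suc:
  "(\<Sum>x\<in>tuples v (Suc k). f x) = (\<Sum>a<v. \<Sum>x\<in>tuples v k. f (a # x))"
  for f :: "nat list \<Rightarrow> 'b::comm_monoid_add"
proof -
  have "inj_on (\<lambda>(a, x). a # x) ({0..<v} \<times> tuples v k)"
    by (auto simp: inj_on_def)
  then show ?thesis
    by (simp add: tuples_Suc sum.reindex sum.cartesian_product comp_def prod.case_distrib
        lessThan_atLeast0)
qed

text \<open>A line is given by the entries \<open>p\<close> before and \<open>s\<close> after its
  free position. The guard \<open>0 < k\<close> counters the truncation of \<open>k - 1\<close>:
  without it, \<open>k = 0\<close> would impose a condition on words of length 1.\<close>

definition line_sums_zero :: "nat \<Rightarrow> nat \<Rightarrow> (nat list \<Rightarrow> real) \<Rightarrow> bool" where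
  "line_sums_zero v k T \<longleftrightarrow>
     (\<forall>p s. p @ s \<in> tuples v (k - 1) \<longrightarrow> 0 < k \<longrightarrow> (\<Sum>a<v. T (p @ a # s)) = 0)"

text \<open>A line in the slice with first letter \<open>a\<close> is a line of the whole space with
  prefix \<open>a # p\<close>. This drives the induction on the number of positions.\<close>

lemma line_sums_zero_Cons:
  assumes "line_sums_zero v (Suc k) T" and "a < v"
  shows "line_sums_zero v k (\<lambda>x. T (a # x))"
  unfolding line_sums_zero_def
proof (intro allI impI)
  fix p s assume "p @ s \<in> tuples v (k - 1)" "0 < k"
  then have "(a # p) @ s \<in> tuples v (Suc k - 1)"
    using assms(2) by (auto simp: tuples_def)
  then have "(\<Sum>b<v. T ((a # p) @ b # s)) = 0"
    using assms(1) unfolding line_sums_zero_def by blast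
  then show "(\<Sum>b<v. T (a # p @ b # s)) = 0"
    by simp
qed

lemma line_sums_zero_expansion:
  assumes "line_sums_zero v k T" and "z \<in> tuples v k"
  shows "(\<Sum>x\<in>tuples v k. T x * diff_coeff (map (\<lambda>a. (a, 0)) x) z) = T z"
  using assms
proof (induction k arbitrary: T z)
  case 0
  then show ?case by (simp add: tuples_0)
next
  case (Suc k)
  obtain b y where z: "z = b # y" "b < v" "y \<in> tuples v k"
    using Suc.prems(2) by (auto simp: tuples_Suc)
  have line: "(\<Sum>a<v. T (a # y)) = 0"
    using Suc.prems(1)[unfolded line_sums_zero_def, rule_format, of "[]" y] z by simp
  have IH: "(\<Sum>x\<in>tuples v k. T (a # x) * diff_coeff (map (\<lambda>a. (a, 0)) x) y) = T (a # y)"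
    if "a < v" for a
    using Suc.IH[OF line_sums_zero_Cons[OF Suc.prems(1) that] z(3)] by simp
  have "(\<Sum>x\<in>tuples v (Suc k). T x * diff_coeff (map (\<lambda>a. (a, 0)) x) z) =
      (\<Sum>a<v. (of_bool (b = a) - of_bool (b = 0)) *
        (\<Sum>x\<in>tuples v k. T (a # x) * diff_coeff (map (\<lambda>a. (a, 0)) x) y))"
    by (simp add: sum_tuples_Suc z(1) sum_distrib_left mult.left_commute)
  also have "\<dots> = (\<Sum>a<v. (of_bool (b = a) - of_bool (b = 0)) * T (a # y))"
    by (simp add: IH)
  \<comment> \<open>The last sum runs over the line through \<open>y\<close> in the first direction,
    hence is 0; the other one keeps only \<open>T (b # y)\<close>.\<close>
  also have "\<dots> = (\<Sum>a<v. of_bool (b = a) * T (a # y)) - of_bool (b = 0) * (\<Sum>a<v. T (a # y))"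
    by (simp add: left_diff_distrib sum_subtractf sum_distrib_left)
  also have "\<dots> = T z"
    using z(1,2) by (simp add: line of_bool_def if_distrib[of "\<lambda>c. c * _"] sum.delta cong: if_cong)
  finally show ?case .
qed

text \<open>Along the line only the factor at the free position varies, and it sums to 1 - 1 = 0
  because both of its letters lie below \<open>v\<close>. If \<open>ps\<close> is too short to reach
  that position, every term is 0.\<close>

lemma line_sum_diff_coeff:
  assumes "\<forall>(a, b)\<in>set ps. a < v \<and> b < v"
  shows "(\<Sum>c<v. diff_coeff ps (p @ c # s)) = 0"
  using assms
proof (induction ps p rule: diff_coeff.induct)
  case (2 a b ps c cs)
  then show ?case by (simp flip: sum_distrib_left)
next
  \<comment> \<open>The prefix is exhausted, so the summed letter meets the head factor of the
    list.\<close>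
  case ("3_1" p ps)
  obtain a b where p: "p = (a, b)" by force
  with "3_1" show ?case
    by (simp add: flip: sum_distrib_right) (simp add: sum_subtractf of_bool_def)
qed auto

lemma diff_coeff_eq_0:
  "(a, a) \<in> set ps \<Longrightarrow> diff_coeff ps x = 0"
  by (induction ps x rule: diff_coeff.induct) auto

section \<open>Rows of the inclusion matrix as axis-parallel lines\<close>

lemma sorted_list_of_set_omit_one:
  assumes "1 \<le> m" and "m \<le> n"
  shows "sorted_list_of_set ({1..n} - {m}) = [1..<m] @ [Suc m..<Suc n]"
proof -
  have "set ([1..<m] @ [Suc m..<Suc n]) = {1..n} - {m}"
    using assms by auto
  moreover have "sorted ([1..<m] @ [Suc m..<Suc n])" "distinct ([1..<m] @ [Suc m..<Suc n])"
    by (auto simp: sorted_append)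
  ultimately show ?thesis
    by (metis sorted_list_of_set.idem_if_sorted_distinct)
qed

text \<open>The omitted position, counted from 1, is \<open>Suc (length p)\<close>.\<close>

lemma occurs_in_omit_one:
  assumes "length p + length s = t" and "length x = Suc t"
  shows "occurs_in ({1..Suc t} - {Suc (length p)}, p @ s) x \<longleftrightarrow> (\<exists>a. x = p @ a # s)"
proof -
  let ?m = "length p"
  have card: "card ({1..Suc t} - {Suc ?m}) = t"
    using assms(1) by simp
  \<comment> \<open>After conversion to indices from 0, positions before the gap keep their index
    and later ones move up by one.\<close>
  have nth: "sorted_list_of_set ({1..Suc t} - {Suc ?m}) ! j - 1 = (if j < ?m then j else Suc j)"
    if "j < t" for j
    using that assms(1) by (subst sorted_list_of_set_omit_one) (auto simp: nth_append simp del: upt_Suc)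
  have "occurs_in ({1..Suc t} - {Suc ?m}, p @ s) x \<longleftrightarrow>
      (\<forall>j<t. (p @ s) ! j = x ! (if j < ?m then j else Suc j))"
    unfolding occurs_in_def prod.case card using nth by auto
  also have "\<dots> \<longleftrightarrow> (\<exists>a. x = p @ a # s)"
  proof
    assume *: "\<forall>j<t. (p @ s) ! j = x ! (if j < ?m then j else Suc j)"
    \<comment> \<open>The free letter has to be the entry of \<open>x\<close> at the omitted
      position.\<close>
    have nth_eq: "x ! i = (p @ x ! ?m # s) ! i" if "i < Suc t" for i
    proof (cases i ?m rule: linorder_cases)
      case less
      then show ?thesis using *[rule_format, of i] assms(1) by (simp add: nth_append)
    next
      case greater
      then obtain j where "i = Suc j" "?m \<le> j" by (cases i) auto
      then show ?thesis using *[rule_format, of j] that by (simp add: nth_append Suc_diff_le)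
    qed simp
    have "x = p @ x ! ?m # s"
      by (rule nth_equalityI) (use assms in simp, use assms(2) nth_eq in metis)
    then show "\<exists>a. x = p @ a # s" ..
  qed (auto simp: nth_append Suc_diff_le)
  finally show ?thesis .
qed

text \<open>The columns with entry 1 in this row are exactly the points of one line, parametrized
  injectively by the free letter.\<close>

lemma row_sum_eq_line_sum:
  assumes "p @ s \<in> tuples v t"
  shows "(\<Sum>x\<in>tuples v (Suc t). incl_entry ({1..Suc t} - {Suc (length p)}, p @ s) x * T x) =
    (\<Sum>a<v. T (p @ a # s))"
proof -
  have ps: "length p + length s = t" "set p \<subseteq> {0..<v}" "set s \<subseteq> {0..<v}"
    using assms by (auto simp: tuples_def)
  let ?L = "(\<lambda>a. p @ a # s) ` {..<v}"
  have entry: "incl_entry ({1..Suc t} - {Suc (length p)}, p @ s) x = of_bool (x \<in> ?L)"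
    if "x \<in> tuples v (Suc t)" for x
    using that occurs_in_omit_one[OF ps(1), of x] by (auto simp: incl_entry_def tuples_def)
  have "(\<Sum>x\<in>tuples v (Suc t). incl_entry ({1..Suc t} - {Suc (length p)}, p @ s) x * T x) =
      (\<Sum>x\<in>tuples v (Suc t). of_bool (x \<in> ?L) * T x)"
    by (intro sum.cong refl arg_cong2[of _ _ _ _ "(*)"] entry)
  also have "\<dots> = (\<Sum>x\<in>?L. T x)"
    using ps by (intro sum.mono_neutral_cong_right finite_tuples) (auto simp: tuples_def subset_iff)
  also have "\<dots> = (\<Sum>a<v. T (p @ a # s))"
    by (subst sum.reindex) (auto simp: inj_on_def)
  finally show ?thesis .
qed

text \<open>A \<open>t\<close>-subset of \<open>{1..Suc t}\<close> misses a single position, so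
  cutting \<open>u\<close> there into \<open>p\<close> and \<open>s\<close> records both the subset
  and the word.\<close>

lemma incl_rows_Suc:
  "incl_rows t v (Suc t) =
    {({1..Suc t} - {Suc (length p)}, p @ s) | p s. p @ s \<in> tuples v t}"
proof (intro set_eqI iffI; clarify)
  fix I u assume "(I, u) \<in> incl_rows t v (Suc t)"
  then have I: "I \<subseteq> {1..Suc t}" "card I = t" and u: "u \<in> tuples v t"
    by (auto simp: incl_rows_def)
  have "card ({1..Suc t} - I) = 1"
    using I by (simp add: card_Diff_subset finite_subset[of I "{1..Suc t}"])
  then obtain m where m: "{1..Suc t} - I = {m}"
    by (auto simp: card_1_singleton_iff)
  then have "m \<in> {1..Suc t}"
    by blast
  then have "1 \<le> m" "m \<le> Suc t"
    by simp_all
  moreover have "I = {1..Suc t} - {m}"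
    using m I(1) by blast
  moreover have "length (take (m - 1) u) = m - 1"
    using u \<open>m \<le> Suc t\<close> by (auto simp: tuples_def)
  \<comment> \<open>If \<open>m\<close> is the missing position, \<open>m - 1\<close> entries of
    \<open>u\<close> precede it.\<close>
  ultimately show "\<exists>p s. (I, u) = ({1..Suc t} - {Suc (length p)}, p @ s) \<and> p @ s \<in> tuples v t"
    using u by (intro exI[of _ "take (m - 1) u"] exI[of _ "drop (m - 1) u"]) simp
next
  fix p s assume "p @ s \<in> tuples v t"
  then show "({1..Suc t} - {Suc (length p)}, p @ s) \<in> incl_rows t v (Suc t)"
    by (auto simp: incl_rows_def tuples_def)
qed

lemma null_space_iff_line_sums_zero:
  "T \<in> null_space (incl_rows t v (Suc t)) (tuples v (Suc t)) incl_entry \<longleftrightarrow>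
    (\<forall>x. x \<notin> tuples v (Suc t) \<longrightarrow> T x = 0) \<and> line_sums_zero v (Suc t) T"
proof -
  have "(\<forall>r\<in>incl_rows t v (Suc t). (\<Sum>x\<in>tuples v (Suc t). incl_entry r x * T x) = 0) \<longleftrightarrow>
      (\<forall>p s. p @ s \<in> tuples v t \<longrightarrow> (\<Sum>x\<in>tuples v (Suc t).
        incl_entry ({1..Suc t} - {Suc (length p)}, p @ s) x * T x) = 0)"
    unfolding incl_rows_Suc by blast
  also have "\<dots> \<longleftrightarrow> (\<forall>p s. p @ s \<in> tuples v t \<longrightarrow> (\<Sum>a<v. T (p @ a # s)) = 0)"
    by (simp only: row_sum_eq_line_sum cong: imp_cong)
  finally show ?thesis
    by (simp only: null_space_def line_sums_zero_def mem_Collect_eq diff_Suc_1 zero_less_Suc simp_thms)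
qed

lemma subspace_null_space: "subspace (null_space R C A)"
  unfolding subspace_def null_space_def
  by (auto simp: scaleR_fun_def distrib_left sum.distrib mult.left_commute simp flip: sum_distrib_left)

lemma sum_fun_eval: "(\<Sum>i\<in>A. f i) x = (\<Sum>i\<in>A. f i x)"
  for f :: "'i \<Rightarrow> 'a \<Rightarrow> 'b::comm_monoid_add"
  by (induction A rule: infinite_finite_induct) auto

section \<open>Intercalates lie in the null space and span it\<close>

lemma intercalate_iff:
  "intercalate t v p \<longleftrightarrow> (\<exists>ps. length ps = Suc t \<and>
    (\<forall>(a, b)\<in>set ps. a < v \<and> b < v \<and> a \<noteq> b) \<and> p = (\<Prod>(a, b)\<leftarrow>ps. nc_var a - nc_var b))"
  (is "_ \<longleftrightarrow> ?R")
proof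
  assume "intercalate t v p"
  then obtain i j where ij: "\<forall>l\<in>{1..t+1}. i l < v \<and> j l < v \<and> i l \<noteq> j l"
    and p: "p = (\<Prod>l\<leftarrow>[1..<t+2]. nc_var (i l) - nc_var (j l))"
    unfolding intercalate_def by blast
  show ?R
    using ij by (intro exI[of _ "map (\<lambda>l. (i l, j l)) [1..<t+2]"]) (auto simp: p comp_def simp del: upt_Suc)
next
  assume ?R
  then obtain ps where ps: "length ps = Suc t" "\<forall>(a, b)\<in>set ps. a < v \<and> b < v \<and> a \<noteq> b"
    and p: "p = (\<Prod>(a, b)\<leftarrow>ps. nc_var a - nc_var b)"
    by blast
  have "ps ! (l - 1) \<in> set ps" if "l \<in> {1..t+1}" for l
    using that ps(1) by (intro nth_mem) auto
  moreover have "map (\<lambda>(a, b). nc_var a - nc_var b) ps =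
      map (\<lambda>l. nc_var (fst (ps ! (l - 1))) - nc_var (snd (ps ! (l - 1)))) [1..<t+2]"
    using ps(1) by (intro nth_equalityI) (auto simp: case_prod_beta simp del: upt_Suc)
  ultimately show "intercalate t v p"
    unfolding intercalate_def p using ps(2)
    by (intro exI[of _ "\<lambda>l. fst (ps ! (l - 1))"] exI[of _ "\<lambda>l. snd (ps ! (l - 1))"])
      (auto simp: case_prod_beta)
qed

lemma freq_vec_intercalate_in_null_space:
  assumes "intercalate t v p"
  shows "freq_vec v (Suc t) p \<in> null_space (incl_rows t v (Suc t)) (tuples v (Suc t)) incl_entry"
proof -
  obtain ps where ps: "\<forall>(a, b)\<in>set ps. a < v \<and> b < v"
    and p: "p = (\<Prod>(a, b)\<leftarrow>ps. nc_var a - nc_var b)"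
    using assms unfolding intercalate_iff by fast
  have "(\<Sum>a<v. freq_vec v (Suc t) p (q @ a # s)) = 0" if "q @ s \<in> tuples v t" for q s
  proof -
    \<comment> \<open>Every point of the line is a tuple over \<open>v\<close>, so the cut-off in
      \<open>freq_vec\<close> has no effect here.\<close>
    have "(\<Sum>a<v. freq_vec v (Suc t) p (q @ a # s)) = (\<Sum>a<v. diff_coeff ps (q @ a # s))"
      using that by (intro sum.cong) (auto simp: freq_vec_def p lookup_prod_diff tuples_def)
    then show ?thesis
      by (simp add: line_sum_diff_coeff[OF ps])
  qed
  then show ?thesis
    unfolding null_space_iff_line_sums_zero line_sums_zero_def by (simp add: freq_vec_def)
qed

lemma null_space_subset_span_intercalates:
  "null_space (incl_rows t v (Suc t)) (tuples v (Suc t)) incl_entry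
    \<subseteq> span {freq_vec v (Suc t) p | p. intercalate t v p}"
    (is "_ \<subseteq> span ?S")
proof
  fix T assume "T \<in> null_space (incl_rows t v (Suc t)) (tuples v (Suc t)) incl_entry"
  then have supp: "\<And>x. x \<notin> tuples v (Suc t) \<Longrightarrow> T x = 0" and lines: "line_sums_zero v (Suc t) T"
    by (simp_all add: null_space_iff_line_sums_zero)
  \<comment> \<open>The product in which every factor subtracts \<open>x_0\<close>; its coefficient
    in the expansion of \<open>T\<close> is \<open>T x\<close> itself.\<close>
  define g where "g x = freq_vec v (Suc t) (\<Prod>(a, b)\<leftarrow>map (\<lambda>a. (a, 0)) x. nc_var a - nc_var b)"
    for x
  have g: "g x z = (if z \<in> tuples v (Suc t) then diff_coeff (map (\<lambda>a. (a, 0)) x) z else 0)" for x z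
    unfolding g_def freq_vec_def lookup_prod_diff ..
  have "T = (\<Sum>x\<in>tuples v (Suc t). T x *\<^sub>R g x)"
  proof
    fix z
    show "T z = (\<Sum>x\<in>tuples v (Suc t). T x *\<^sub>R g x) z"
      using supp[of z] line_sums_zero_expansion[OF lines, of z]
      by (cases "z \<in> tuples v (Suc t)") (simp_all add: sum_fun_eval scaleR_fun_def g)
  qed
  also have "\<dots> \<in> span ?S"
  proof (intro span_sum span_scale)
    fix x assume x: "x \<in> tuples v (Suc t)"
    show "g x \<in> span ?S"
    proof (cases "0 \<in> set x")
      \<comment> \<open>A letter 0 yields the factor \<open>x_0 - x_0\<close>, which intercalates
        exclude, but then the whole product vanishes.\<close>
      case True
      then have "g x = 0"
        by (auto simp: fun_eq_iff g intro!: diff_coeff_eq_0)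
      then show ?thesis
        by (simp add: span_zero)
    next
      case False
      have "intercalate t v (\<Prod>(a, b)\<leftarrow>map (\<lambda>a. (a, 0)) x. nc_var a - nc_var b)"
        unfolding intercalate_iff using x False
        by (intro exI[of _ "map (\<lambda>a. (a, 0)) x"]) (fastforce simp: tuples_def)
      then show ?thesis
        unfolding g_def by (blast intro: span_base)
    qed
  qed
  finally show "T \<in> span ?S" .
qed

theorem theorem3:
  fixes v t :: nat
  assumes "v \<ge> 2" and "t \<ge> 1"
  shows "\<exists>B. B \<subseteq> {freq_vec v (t + 1) p | p. intercalate t v p} \<and>
             independent B \<and>
             span B = null_space (incl_rows t v (t + 1)) (tuples v (t + 1)) incl_entry"
proof -
  let ?S = "{freq_vec v (t + 1) p | p. intercalate t v p}"
  let ?N = "null_space (incl_rows t v (t + 1)) (tuples v (t + 1)) incl_entry"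
  \<comment> \<open>A maximal independent subset of \<open>?S\<close> still spans \<open>?S\<close>,
    and \<open>?N\<close> is a subspace lying between \<open>?S\<close> and
    \<open>span ?S\<close>.\<close>
  obtain B where B: "B \<subseteq> ?S" "independent B" "?S \<subseteq> span B"
    using maximal_independent_subset[of ?S] by blast
  have "?S \<subseteq> ?N"
    using freq_vec_intercalate_in_null_space by auto
  then have "span B \<subseteq> ?N"
    using B(1) by (intro span_minimal subspace_null_space) blast
  moreover have "?N \<subseteq> span B"
    using null_space_subset_span_intercalates[of t v] span_minimal[OF B(3) subspace_span] by simp
  ultimately show ?thesis
    using B by blast
qed

end
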